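(* Let $H$ be a Hopf algebra over a field $\Bbbk$ and let $(\rightharpoonup, A, \leftharpoonup)$ be a unital partial $H$-bimodule algebra. Let $\mathcal{H}=\mathrm{Hom}_{\Bbbk}(H\otimes H, A)$ be the convolution algebra, with the $H$-bimodule structure $(h\triangleright f)(k\otimes k')=f(kh\otimes k')$ and $(f\triangleleft h)(k\otimes k')=f(k\otimes hk')$. Define $\varphi:A\to\mathcal{H}$ by $\varphi(a)(k\otimes k')=k\rightharpoonup a\leftharpoonup k'$, and let $B=H\triangleright\varphi(A)\triangleleft H\subseteq\mathcal{H}$. Then the pair $(B,\varphi)$ is a globalization of $A$.
   Context: Algebras are over $\Bbbk$, associative, not necessarily unital; linear means $\Bbbk$-linear; $\otimes=\otimes_\Bbbk$. $H$ has comultiplication $\Delta(h)=h_1\otimes h_2$ (summation understood), counit $\varepsilon$, antipode $S$. An algebra $A$ is a left partial $H$-module algebra if there is a linear map $\rightharpoonup:H\otimes A\to A$ with $1_H\rightharpoonup a=a$ and $h\rightharpoonup[a(g\rightharpoonup b)]=(h_1\rightharpoonup a)(h_2g\rightharpoonup b)$ for all $a,b\in A$, $g,h\in H$. It is a right partial $H$-module algebra if there is a linear map $\leftharpoonup:A\otimes H\to A$ with $a\leftharpoonup 1_H=a$ and $[(b\leftharpoonup g)a]\leftharpoonup h=(b\leftharpoonup gh_1)(a\leftharpoonup h_2)$. It is a partial $H$-bimodule algebra $(\rightharpoonup,A,\leftharpoonup)$ if it is both and $h\rightharpoonup(a\leftharpoonup g)=(h\rightharpoonup a)\leftharpoonup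 g$ for all $a\in A$, $g,h\in H$. It is called unital if $A$ has an identity $1_A$. An $H$-bimodule algebra $(\triangleright,B,\triangleleft)$ is an algebra $B$ that is an $H$-bimodule (so $1_H\triangleright b=b=b\triangleleft 1_H$, $h\triangleright(g\triangleright b)=hg\triangleright b$, $(b\triangleleft g)\triangleleft h=b\triangleleft gh$, $h\triangleright(b\triangleleft g)=(h\triangleright b)\triangleleft g$) with $h\triangleright(bc)=(h_1\triangleright b)(h_2\triangleright c)$ and $(bc)\triangleleft h=(b\triangleleft h_1)(c\triangleleft h_2)$. A globalization of a unital partial $H$-bimodule algebra $A$ is a pair $((\triangleright,B,\triangleleft),\theta)$, where $(\triangleright,B,\triangleleft)$ is a (not necessarily unital) $H$-bimodule algebra and $\theta:A\to B$ is an algebra monomorphism such that (1) $(\theta(a)\triangleleft h)(g\triangleright\theta(b))=\theta[(a\leftharpoonup h)(g\rightharpoonup b)]$ for all $h,g\in H$, $a,b\in A$; (2) $B=H\triangleright\theta(A)\triangleleft H$, the linear span of the elements $h\triangleright\theta(a)\triangleleft k$. The convolution product on $\mathcal{H}$ is $(f\ast g)(k\otimes k')=f(k_1\otimes k'_1)g(k_2\otimes k'_2)$; the $H$-bimodule structure on $B$ is the restriction of the one on $\mathcal{H}$. *)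

theory Defs
  imports Complex_Main "HOL-Library.Poly_Mapping" "HOL-Library.Function_Algebras"
begin

section \<open>Bilinear maps and tensor products over a field\<close>

text \<open>
  Vector spaces are types of class \<^class>\<open>ab_group_add\<close> with an explicit scalar multiplication
  satisfying \<^locale>\<open>vector_space\<close>, or subspaces of such types.
\<close>

definition bilinear_on ::
  "('k::field \<Rightarrow> 'v::ab_group_add \<Rightarrow> 'v) \<Rightarrow> 'v set \<Rightarrow> ('k \<Rightarrow> 'w::ab_group_add \<Rightarrow> 'w) \<Rightarrow> 'w set \<Rightarrow>
    ('k \<Rightarrow> 'u::ab_group_add \<Rightarrow> 'u) \<Rightarrow> ('v \<Rightarrow> 'w \<Rightarrow> 'u) \<Rightarrow> bool"
  where "bilinear_on sV V sW W sU \<beta> \<longleftrightarrow>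
    (\<forall>x\<in>V. \<forall>x'\<in>V. \<forall>y\<in>W. \<beta> (x + x') y = \<beta> x y + \<beta> x' y) \<and>
    (\<forall>x\<in>V. \<forall>y\<in>W. \<forall>y'\<in>W. \<beta> x (y + y') = \<beta> x y + \<beta> x y') \<and>
    (\<forall>c. \<forall>x\<in>V. \<forall>y\<in>W. \<beta> (sV c x) y = sU c (\<beta> x y)) \<and>
    (\<forall>c. \<forall>x\<in>V. \<forall>y\<in>W. \<beta> x (sW c y) = sU c (\<beta> x y))"

definition free_scale :: "'k::field \<Rightarrow> ('x \<Rightarrow>\<^sub>0 'k) \<Rightarrow> ('x \<Rightarrow>\<^sub>0 'k)"
  where "free_scale c p = Poly_Mapping.map ((*) c) p"

definition gen :: "'x \<Rightarrow> ('x \<Rightarrow>\<^sub>0 'k::field)"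
  where "gen x = Poly_Mapping.single x 1"

definition linear_ext :: "('k::field \<Rightarrow> 'u::ab_group_add \<Rightarrow> 'u) \<Rightarrow> ('x \<Rightarrow> 'u) \<Rightarrow> ('x \<Rightarrow>\<^sub>0 'k) \<Rightarrow> 'u"
  where "linear_ext sU f p = (\<Sum>x\<in>Poly_Mapping.keys p. sU (Poly_Mapping.lookup p x) (f x))"

text \<open>
  The tensor product of \<open>V\<close> and \<open>W\<close> is the free vector space on \<open>V \<times> W\<close> modulo the bilinearity
  relations; its elements are cosets.
\<close>

type_synonym ('k, 'v, 'w) tensor = "('v \<times> 'w \<Rightarrow>\<^sub>0 'k) set"

definition tensor_rel ::
  "('k::field \<Rightarrow> 'v::ab_group_add \<Rightarrow> 'v) \<Rightarrow> ('k \<Rightarrow> 'w::ab_group_add \<Rightarrow> 'w) \<Rightarrow> ('v \<times> 'w \<Rightarrow>\<^sub>0 'k) set"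
  where "tensor_rel sV sW = module.span free_scale
    ({gen (x + x', y) - gen (x, y) - gen (x', y) | x x' y. True} \<union>
     {gen (x, y + y') - gen (x, y) - gen (x, y') | x y y'. True} \<union>
     {gen (sV c x, y) - free_scale c (gen (x, y)) | c x y. True} \<union>
     {gen (x, sW c y) - free_scale c (gen (x, y)) | c x y. True})"

definition tensor_class ::
  "('k::field \<Rightarrow> 'v::ab_group_add \<Rightarrow> 'v) \<Rightarrow> ('k \<Rightarrow> 'w::ab_group_add \<Rightarrow> 'w) \<Rightarrow>
    ('v \<times> 'w \<Rightarrow>\<^sub>0 'k) \<Rightarrow> ('k, 'v, 'w) tensor"
  where "tensor_class sV sW p = {q. q - p \<in> tensor_rel sV sW}"

definition tensor_space ::
  "('k::field \<Rightarrow> 'v::ab_group_add \<Rightarrow> 'v) \<Rightarrow> ('k \<Rightarrow> 'w::ab_group_add \<Rightarrow> 'w) \<Rightarrow> ('k, 'v, 'w) tensor set"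
  where "tensor_space sV sW = range (tensor_class sV sW)"

definition pure_tensor ::
  "('k::field \<Rightarrow> 'v::ab_group_add \<Rightarrow> 'v) \<Rightarrow> ('k \<Rightarrow> 'w::ab_group_add \<Rightarrow> 'w) \<Rightarrow>
    'v \<Rightarrow> 'w \<Rightarrow> ('k, 'v, 'w) tensor"
  where "pure_tensor sV sW x y = tensor_class sV sW (gen (x, y))"

definition tensor_add ::
  "('k::field \<Rightarrow> 'v::ab_group_add \<Rightarrow> 'v) \<Rightarrow> ('k \<Rightarrow> 'w::ab_group_add \<Rightarrow> 'w) \<Rightarrow>
    ('k, 'v, 'w) tensor \<Rightarrow> ('k, 'v, 'w) tensor \<Rightarrow> ('k, 'v, 'w) tensor"
  where "tensor_add sV sW s t = (\<Union>p\<in>s. \<Union>q\<in>t. tensor_class sV sW (p + q))"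

definition tensor_scale ::
  "('k::field \<Rightarrow> 'v::ab_group_add \<Rightarrow> 'v) \<Rightarrow> ('k \<Rightarrow> 'w::ab_group_add \<Rightarrow> 'w) \<Rightarrow>
    'k \<Rightarrow> ('k, 'v, 'w) tensor \<Rightarrow> ('k, 'v, 'w) tensor"
  where "tensor_scale sV sW c t = (\<Union>p\<in>t. tensor_class sV sW (free_scale c p))"

text \<open>
  \<open>tensor_lift sU \<beta> t\<close> is the sum of the \<open>\<beta> x y\<close> over a representation of \<open>t\<close> as a sum of pure
  tensors \<open>x \<otimes> y\<close>, i.e. what Sweedler notation abbreviates. It does not depend on the
  representation chosen if \<open>\<beta>\<close> is bilinear, see \<open>tensor_lift_class\<close> below.
\<close>

definition tensor_lift ::
  "('k::field \<Rightarrow> 'u::ab_group_add \<Rightarrow> 'u) \<Rightarrow> ('v \<Rightarrow> 'w \<Rightarrow> 'u) \<Rightarrow> ('k, 'v, 'w) tensor \<Rightarrow> 'u"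
  where "tensor_lift sU \<beta> t = linear_ext sU (\<lambda>(x, y). \<beta> x y) (SOME p. p \<in> t)"

definition tensor3_rel ::
  "('k::field \<Rightarrow> 'v::ab_group_add \<Rightarrow> 'v) \<Rightarrow> ('v \<times> 'v \<times> 'v \<Rightarrow>\<^sub>0 'k) set"
  where "tensor3_rel sV = module.span free_scale
    ({gen (x + x', y, z) - gen (x, y, z) - gen (x', y, z) | x x' y z. True} \<union>
     {gen (x, y + y', z) - gen (x, y, z) - gen (x, y', z) | x y y' z. True} \<union>
     {gen (x, y, z + z') - gen (x, y, z) - gen (x, y, z') | x y z z'. True} \<union>
     {gen (sV c x, y, z) - free_scale c (gen (x, y, z)) | c x y z. True} \<union>
     {gen (x, sV c y, z) - free_scale c (gen (x, y, z)) | c x y z. True} \<union>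
     {gen (x, y, sV c z) - free_scale c (gen (x, y, z)) | c x y z. True})"

definition tensor3_class ::
  "('k::field \<Rightarrow> 'v::ab_group_add \<Rightarrow> 'v) \<Rightarrow> ('v \<times> 'v \<times> 'v \<Rightarrow>\<^sub>0 'k) \<Rightarrow> ('v \<times> 'v \<times> 'v \<Rightarrow>\<^sub>0 'k) set"
  where "tensor3_class sV p = {q. q - p \<in> tensor3_rel sV}"

subsection \<open>Universal property\<close>

lemma lookup_free_scale [simp]:
  "Poly_Mapping.lookup (free_scale c p) x = c * Poly_Mapping.lookup p x"
  by (simp add: free_scale_def map.rep_eq when_def)

lemma vector_space_free_scale: "vector_space (free_scale :: 'k::field \<Rightarrow> ('x \<Rightarrow>\<^sub>0 'k) \<Rightarrow> _)"
  by unfold_locales (simp_all add: poly_mapping_eq_iff fun_eq_iff lookup_add algebra_simps)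

lemma linear_linear_ext:
  fixes sU :: "'k::field \<Rightarrow> 'u::ab_group_add \<Rightarrow> 'u" and f :: "'x \<Rightarrow> 'u"
  assumes "vector_space sU"
  shows "Vector_Spaces.linear free_scale sU (linear_ext sU f)"
proof -
  interpret U: vector_space sU by fact
  have sup: "linear_ext sU f p = (\<Sum>x\<in>K. sU (Poly_Mapping.lookup p x) (f x))"
    if "finite K" "Poly_Mapping.keys p \<subseteq> K" for p :: "'x \<Rightarrow>\<^sub>0 'k" and K
    unfolding linear_ext_def using that
    by (intro sum.mono_neutral_left) (auto simp: in_keys_iff)
  show ?thesis
  proof (intro Vector_Spaces.linear_iff[THEN iffD2] conjI allI vector_space_free_scale assms)
    fix p q :: "'x \<Rightarrow>\<^sub>0 'k"
    let ?K = "Poly_Mapping.keys p \<union> Poly_Mapping.keys q"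
    have "Poly_Mapping.keys (p + q) \<subseteq> ?K" by (rule Poly_Mapping.keys_add)
    then show "linear_ext sU f (p + q) = linear_ext sU f p + linear_ext sU f q"
      by (simp add: sup[of ?K] lookup_add U.scale_left_distrib sum.distrib)
  next
    fix c and p :: "'x \<Rightarrow>\<^sub>0 'k"
    have "Poly_Mapping.keys (free_scale c p) \<subseteq> Poly_Mapping.keys p"
      by (auto simp: in_keys_iff)
    then show "linear_ext sU f (free_scale c p) = sU c (linear_ext sU f p)"
      by (simp add: sup[of "Poly_Mapping.keys p"] U.scale_sum_right)
  qed
qed

lemma linear_ext_gen:
  assumes "vector_space sU"
  shows "linear_ext sU f (gen x) = f x"
proof -
  interpret U: vector_space sU by fact
  show ?thesis by (simp add: linear_ext_def gen_def)
qed

lemma linear_ext_tensor_rel: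
  assumes U: "vector_space sU" and \<beta>: "bilinear_on sV UNIV sW UNIV sU \<beta>"
    and p: "p \<in> tensor_rel sV sW"
  shows "linear_ext sU (\<lambda>(x, y). \<beta> x y) p = 0"
proof -
  interpret L: Vector_Spaces.linear free_scale sU "linear_ext sU (\<lambda>(x, y). \<beta> x y)"
    by (rule linear_linear_ext[OF U])
  show ?thesis
    by (rule L.eq_0_on_span[OF _ p[unfolded tensor_rel_def]])
       (use \<beta> in \<open>auto simp: bilinear_on_def L.diff L.scale linear_ext_gen[OF U]\<close>)
qed

lemma tensor_lift_class:
  assumes U: "vector_space sU" and \<beta>: "bilinear_on sV UNIV sW UNIV sU \<beta>"
  shows "tensor_lift sU \<beta> (tensor_class sV sW p) = linear_ext sU (\<lambda>(x, y). \<beta> x y) p"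
proof -
  interpret L: Vector_Spaces.linear free_scale sU "linear_ext sU (\<lambda>(x, y). \<beta> x y)"
    by (rule linear_linear_ext[OF U])
  let ?q = "SOME q. q \<in> tensor_class sV sW p"
  have "p \<in> tensor_class sV sW p"
    by (simp add: tensor_class_def tensor_rel_def L.vs1.span_zero)
  then have "?q \<in> tensor_class sV sW p" by (rule someI)
  then have "linear_ext sU (\<lambda>(x, y). \<beta> x y) (?q - p) = 0"
    by (intro linear_ext_tensor_rel[OF U \<beta>]) (simp add: tensor_class_def)
  then show ?thesis by (simp add: tensor_lift_def L.diff)
qed

lemma tensor_lift_pure:
  assumes "vector_space sU" "bilinear_on sV UNIV sW UNIV sU \<beta>"
  shows "tensor_lift sU \<beta> (pure_tensor sV sW x y) = \<beta> x y"
  by (simp add: pure_tensor_def tensor_lift_class[OF assms] linear_ext_gen[OF assms(1)])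


section \<open>Algebras and Hopf algebras\<close>

locale k_algebra = vector_space scale
  for scale :: "'k::field \<Rightarrow> 'b::ab_group_add \<Rightarrow> 'b" +
  fixes B :: "'b set" and mult :: "'b \<Rightarrow> 'b \<Rightarrow> 'b"
  assumes subspace_B: "subspace B"
    and mult_closed: "b \<in> B \<Longrightarrow> c \<in> B \<Longrightarrow> mult b c \<in> B"
    and mult_bilinear: "bilinear_on scale B scale B scale mult"
    and mult_assoc: "b \<in> B \<Longrightarrow> c \<in> B \<Longrightarrow> d \<in> B \<Longrightarrow> mult (mult b c) d = mult b (mult c d)"

text \<open>
  Right-hand sides of the form \<open>tensor_class \<dots> (tensor_lift free_scale \<dots>)\<close> are sums of pure tensors
  over Sweedler components, formed in the free vector space and then projected to the tensor product.
\<close>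

locale hopf_algebra = k_algebra scale UNIV "(*)"
  for scale :: "'k::field \<Rightarrow> 'h::ring_1 \<Rightarrow> 'h" +
  fixes \<Delta> :: "'h \<Rightarrow> ('k, 'h, 'h) tensor"
    and \<epsilon> :: "'h \<Rightarrow> 'k"
    and S :: "'h \<Rightarrow> 'h"
  assumes comult_in: "\<Delta> h \<in> tensor_space scale scale"
    and comult_add: "\<Delta> (h + g) = tensor_add scale scale (\<Delta> h) (\<Delta> g)"
    and comult_scale: "\<Delta> (scale c h) = tensor_scale scale scale c (\<Delta> h)"
    and counit_linear: "Vector_Spaces.linear scale (*) \<epsilon>"
    and coassoc:
      "tensor3_class scale
         (tensor_lift free_scale (\<lambda>x z. tensor_lift free_scale (\<lambda>u v. gen (u, v, z)) (\<Delta> x)) (\<Delta> h)) =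
       tensor3_class scale
         (tensor_lift free_scale (\<lambda>x z. tensor_lift free_scale (\<lambda>u v. gen (x, u, v)) (\<Delta> z)) (\<Delta> h))"
    and counit_left: "tensor_lift scale (\<lambda>h\<^sub>1 h\<^sub>2. scale (\<epsilon> h\<^sub>1) h\<^sub>2) (\<Delta> h) = h"
    and counit_right: "tensor_lift scale (\<lambda>h\<^sub>1 h\<^sub>2. scale (\<epsilon> h\<^sub>2) h\<^sub>1) (\<Delta> h) = h"
    and comult_one: "\<Delta> 1 = pure_tensor scale scale 1 1"
    and comult_mult:
      "\<Delta> (h * g) = tensor_class scale scale
         (tensor_lift free_scale
           (\<lambda>h\<^sub>1 h\<^sub>2. tensor_lift free_scale (\<lambda>g\<^sub>1 g\<^sub>2. gen (h\<^sub>1 * g\<^sub>1, h\<^sub>2 * g\<^sub>2)) (\<Delta> g)) (\<Delta> h))"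
    and counit_one: "\<epsilon> 1 = 1"
    and counit_mult: "\<epsilon> (h * g) = \<epsilon> h * \<epsilon> g"
    and antipode_linear: "Vector_Spaces.linear scale scale S"
    and antipode_left: "tensor_lift scale (\<lambda>h\<^sub>1 h\<^sub>2. S h\<^sub>1 * h\<^sub>2) (\<Delta> h) = scale (\<epsilon> h) 1"
    and antipode_right: "tensor_lift scale (\<lambda>h\<^sub>1 h\<^sub>2. h\<^sub>1 * S h\<^sub>2) (\<Delta> h) = scale (\<epsilon> h) 1"


section \<open>Partial bimodule algebras\<close>

text \<open>
  Linear maps out of \<open>H \<otimes> A\<close> and \<open>A \<otimes> H\<close> that are written as infix actions are given as
  bilinear maps.
\<close>

locale left_partial_module_algebra = k_algebra sA UNIV "(*)"
  for sA :: "'k::field \<Rightarrow> 'a::ring \<Rightarrow> 'a" +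
  fixes sH :: "'k \<Rightarrow> 'h::ring_1 \<Rightarrow> 'h" and \<Delta> :: "'h \<Rightarrow> ('k, 'h, 'h) tensor"
    and lp :: "'h \<Rightarrow> 'a \<Rightarrow> 'a"  (infixr "\<rightharpoonup>" 75)
  assumes lp_bilinear: "bilinear_on sH UNIV sA UNIV sA (\<rightharpoonup>)"
    and lp_one: "1 \<rightharpoonup> a = a"
    and lp_mult: "h \<rightharpoonup> (a * (g \<rightharpoonup> b)) =
      tensor_lift sA (\<lambda>h\<^sub>1 h\<^sub>2. (h\<^sub>1 \<rightharpoonup> a) * ((h\<^sub>2 * g) \<rightharpoonup> b)) (\<Delta> h)"

locale right_partial_module_algebra = k_algebra sA UNIV "(*)"
  for sA :: "'k::field \<Rightarrow> 'a::ring \<Rightarrow> 'a" +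
  fixes sH :: "'k \<Rightarrow> 'h::ring_1 \<Rightarrow> 'h" and \<Delta> :: "'h \<Rightarrow> ('k, 'h, 'h) tensor"
    and rp :: "'a \<Rightarrow> 'h \<Rightarrow> 'a"  (infixl "\<leftharpoonup>" 75)
  assumes rp_bilinear: "bilinear_on sA UNIV sH UNIV sA (\<leftharpoonup>)"
    and rp_one: "a \<leftharpoonup> 1 = a"
    and rp_mult: "((b \<leftharpoonup> g) * a) \<leftharpoonup> h =
      tensor_lift sA (\<lambda>h\<^sub>1 h\<^sub>2. (b \<leftharpoonup> (g * h\<^sub>1)) * (a \<leftharpoonup> h\<^sub>2)) (\<Delta> h)"

locale partial_bimodule_algebra =
  left_partial_module_algebra sA sH \<Delta> lp + right_partial_module_algebra sA sH \<Delta> rp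
  for sA :: "'k::field \<Rightarrow> 'a::ring \<Rightarrow> 'a"
    and sH :: "'k \<Rightarrow> 'h::ring_1 \<Rightarrow> 'h" and \<Delta> :: "'h \<Rightarrow> ('k, 'h, 'h) tensor"
    and lp :: "'h \<Rightarrow> 'a \<Rightarrow> 'a"  (infixr "\<rightharpoonup>" 75)
    and rp :: "'a \<Rightarrow> 'h \<Rightarrow> 'a"  (infixl "\<leftharpoonup>" 75) +
  assumes lp_rp: "h \<rightharpoonup> (a \<leftharpoonup> g) = (h \<rightharpoonup> a) \<leftharpoonup> g"

text \<open>The class \<^class>\<open>ring_1\<close> would exclude the zero algebra.\<close>

locale unital_partial_bimodule_algebra = partial_bimodule_algebra sA sH \<Delta> lp rp
  for sA :: "'k::field \<Rightarrow> 'a::ring \<Rightarrow> 'a"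
    and sH :: "'k \<Rightarrow> 'h::ring_1 \<Rightarrow> 'h" and \<Delta> :: "'h \<Rightarrow> ('k, 'h, 'h) tensor"
    and lp :: "'h \<Rightarrow> 'a \<Rightarrow> 'a"
    and rp :: "'a \<Rightarrow> 'h \<Rightarrow> 'a" +
  assumes unital: "\<exists>e::'a. \<forall>a. e * a = a \<and> a * e = a"


section \<open>Bimodule algebras and globalizations\<close>

locale bimodule_algebra = k_algebra sB B mult
  for sB :: "'k::field \<Rightarrow> 'b::ab_group_add \<Rightarrow> 'b" and B mult
    and sH :: "'k \<Rightarrow> 'h::ring_1 \<Rightarrow> 'h" and \<Delta> :: "'h \<Rightarrow> ('k, 'h, 'h) tensor"
    and la :: "'h \<Rightarrow> 'b \<Rightarrow> 'b"  (infixr "\<triangleright>" 75)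
    and ra :: "'b \<Rightarrow> 'h \<Rightarrow> 'b"  (infixl "\<triangleleft>" 75) +
  assumes la_closed: "b \<in> B \<Longrightarrow> h \<triangleright> b \<in> B"
    and ra_closed: "b \<in> B \<Longrightarrow> b \<triangleleft> h \<in> B"
    and la_bilinear: "bilinear_on sH UNIV sB B sB (\<triangleright>)"
    and ra_bilinear: "bilinear_on sB B sH UNIV sB (\<triangleleft>)"
    and la_one: "b \<in> B \<Longrightarrow> 1 \<triangleright> b = b"
    and ra_one: "b \<in> B \<Longrightarrow> b \<triangleleft> 1 = b"
    and la_la: "b \<in> B \<Longrightarrow> h \<triangleright> (g \<triangleright> b) = (h * g) \<triangleright> b"
    and ra_ra: "b \<in> B \<Longrightarrow> (b \<triangleleft> g) \<triangleleft> h = b \<triangleleft> (g * h)"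
    and la_ra: "b \<in> B \<Longrightarrow> h \<triangleright> (b \<triangleleft> g) = (h \<triangleright> b) \<triangleleft> g"
    and la_mult: "b \<in> B \<Longrightarrow> c \<in> B \<Longrightarrow>
      h \<triangleright> mult b c = tensor_lift sB (\<lambda>h\<^sub>1 h\<^sub>2. mult (h\<^sub>1 \<triangleright> b) (h\<^sub>2 \<triangleright> c)) (\<Delta> h)"
    and ra_mult: "b \<in> B \<Longrightarrow> c \<in> B \<Longrightarrow>
      mult b c \<triangleleft> h = tensor_lift sB (\<lambda>h\<^sub>1 h\<^sub>2. mult (b \<triangleleft> h\<^sub>1) (c \<triangleleft> h\<^sub>2)) (\<Delta> h)"

locale globalization =
  unital_partial_bimodule_algebra sA sH \<Delta> lp rp + B: bimodule_algebra sB B mult sH \<Delta> la ra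
  for sA :: "'k::field \<Rightarrow> 'a::ring \<Rightarrow> 'a"
    and sH :: "'k \<Rightarrow> 'h::ring_1 \<Rightarrow> 'h" and \<Delta> :: "'h \<Rightarrow> ('k, 'h, 'h) tensor"
    and lp :: "'h \<Rightarrow> 'a \<Rightarrow> 'a"  (infixr "\<rightharpoonup>" 75)
    and rp :: "'a \<Rightarrow> 'h \<Rightarrow> 'a"  (infixl "\<leftharpoonup>" 75)
    and sB :: "'k \<Rightarrow> 'b::ab_group_add \<Rightarrow> 'b" and B mult
    and la :: "'h \<Rightarrow> 'b \<Rightarrow> 'b"  (infixr "\<triangleright>" 75)
    and ra :: "'b \<Rightarrow> 'h \<Rightarrow> 'b"  (infixl "\<triangleleft>" 75) +
  fixes \<theta> :: "'a \<Rightarrow> 'b"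
  assumes \<theta>_in: "\<theta> a \<in> B"
    and \<theta>_linear: "Vector_Spaces.linear sA sB \<theta>"
    and \<theta>_mult: "\<theta> (a * b) = mult (\<theta> a) (\<theta> b)"
    and \<theta>_inj: "inj \<theta>"
    and \<theta>_mult_actions: "mult (\<theta> a \<triangleleft> h) (g \<triangleright> \<theta> b) = \<theta> ((a \<leftharpoonup> h) * (g \<rightharpoonup> b))"
    and generated: "B = B.span {(h \<triangleright> \<theta> a) \<triangleleft> k | h a k. True}"


section \<open>The convolution algebra\<close>

text \<open>
  Linear maps \<open>H \<otimes> H \<rightarrow> A\<close> are functions on the type of all sets of formal sums, so they are required
  to vanish outside the tensor product. Addition is the pointwise one of
  \<^theory>\<open>HOL-Library.Function_Algebras\<close>; the pointwise multiplication from there is not used.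
\<close>

definition Hom_tensor ::
  "('k::field \<Rightarrow> 'h::ring_1 \<Rightarrow> 'h) \<Rightarrow> ('k \<Rightarrow> 'a::ring \<Rightarrow> 'a) \<Rightarrow> (('k, 'h, 'h) tensor \<Rightarrow> 'a) set"
  where "Hom_tensor sH sA = {f.
    (\<forall>s\<in>tensor_space sH sH. \<forall>t\<in>tensor_space sH sH. f (tensor_add sH sH s t) = f s + f t) \<and>
    (\<forall>c. \<forall>t\<in>tensor_space sH sH. f (tensor_scale sH sH c t) = sA c (f t)) \<and>
    (\<forall>t. t \<notin> tensor_space sH sH \<longrightarrow> f t = 0)}"

definition hom_scale :: "('k \<Rightarrow> 'a \<Rightarrow> 'a) \<Rightarrow> 'k \<Rightarrow> ('t \<Rightarrow> 'a) \<Rightarrow> ('t \<Rightarrow> 'a)"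
  where "hom_scale sA c f = (\<lambda>t. sA c (f t))"

text \<open>
  For bilinear \<open>\<beta>\<close> this is the linear map with \<open>k \<otimes> k' \<mapsto> \<beta> k k'\<close>, cf. \<open>hom_of_pure\<close> below.
\<close>

definition hom_of ::
  "('k::field \<Rightarrow> 'h::ring_1 \<Rightarrow> 'h) \<Rightarrow> ('k \<Rightarrow> 'a::ring \<Rightarrow> 'a) \<Rightarrow> ('h \<Rightarrow> 'h \<Rightarrow> 'a) \<Rightarrow>
    ('k, 'h, 'h) tensor \<Rightarrow> 'a"
  where "hom_of sH sA \<beta> = (\<lambda>t. if t \<in> tensor_space sH sH then tensor_lift sA \<beta> t else 0)"

definition convolution ::
  "('k::field \<Rightarrow> 'h::ring_1 \<Rightarrow> 'h) \<Rightarrow> ('h \<Rightarrow> ('k, 'h, 'h) tensor) \<Rightarrow> ('k \<Rightarrow> 'a::ring \<Rightarrow> 'a) \<Rightarrow>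
    (('k, 'h, 'h) tensor \<Rightarrow> 'a) \<Rightarrow> (('k, 'h, 'h) tensor \<Rightarrow> 'a) \<Rightarrow> ('k, 'h, 'h) tensor \<Rightarrow> 'a"
  where "convolution sH \<Delta> sA f g = hom_of sH sA (\<lambda>k k'.
    tensor_lift sA (\<lambda>k\<^sub>1 k\<^sub>2.
      tensor_lift sA (\<lambda>k'\<^sub>1 k'\<^sub>2. f (pure_tensor sH sH k\<^sub>1 k'\<^sub>1) * g (pure_tensor sH sH k\<^sub>2 k'\<^sub>2))
        (\<Delta> k')) (\<Delta> k))"

definition hom_left ::
  "('k::field \<Rightarrow> 'h::ring_1 \<Rightarrow> 'h) \<Rightarrow> ('k \<Rightarrow> 'a::ring \<Rightarrow> 'a) \<Rightarrow>
    'h \<Rightarrow> (('k, 'h, 'h) tensor \<Rightarrow> 'a) \<Rightarrow> ('k, 'h, 'h) tensor \<Rightarrow> 'a"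
  where "hom_left sH sA h f = hom_of sH sA (\<lambda>k k'. f (pure_tensor sH sH (k * h) k'))"

definition hom_right ::
  "('k::field \<Rightarrow> 'h::ring_1 \<Rightarrow> 'h) \<Rightarrow> ('k \<Rightarrow> 'a::ring \<Rightarrow> 'a) \<Rightarrow>
    (('k, 'h, 'h) tensor \<Rightarrow> 'a) \<Rightarrow> 'h \<Rightarrow> ('k, 'h, 'h) tensor \<Rightarrow> 'a"
  where "hom_right sH sA f h = hom_of sH sA (\<lambda>k k'. f (pure_tensor sH sH k (h * k')))"

definition phi ::
  "('k::field \<Rightarrow> 'h::ring_1 \<Rightarrow> 'h) \<Rightarrow> ('k \<Rightarrow> 'a::ring \<Rightarrow> 'a) \<Rightarrow>
    ('h \<Rightarrow> 'a \<Rightarrow> 'a) \<Rightarrow> ('a \<Rightarrow> 'h \<Rightarrow> 'a) \<Rightarrow> 'a \<Rightarrow> ('k, 'h, 'h) tensor \<Rightarrow> 'a"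
  where "phi sH sA lp rp a = hom_of sH sA (\<lambda>k k'. rp (lp k a) k')"

definition generated_bimodule ::
  "('k::field \<Rightarrow> 'h::ring_1 \<Rightarrow> 'h) \<Rightarrow> ('k \<Rightarrow> 'a::ring \<Rightarrow> 'a) \<Rightarrow>
    ('h \<Rightarrow> 'a \<Rightarrow> 'a) \<Rightarrow> ('a \<Rightarrow> 'h \<Rightarrow> 'a) \<Rightarrow> (('k, 'h, 'h) tensor \<Rightarrow> 'a) set"
  where "generated_bimodule sH sA lp rp = module.span (hom_scale sA)
    {hom_right sH sA (hom_left sH sA h (phi sH sA lp rp a)) k | h a k. True}"

lemma hom_of_pure:
  assumes "vector_space sA" "bilinear_on sH UNIV sH UNIV sA \<beta>"
  shows "hom_of sH sA \<beta> (pure_tensor sH sH k k') = \<beta> k k'"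
  using tensor_lift_pure[OF assms] by (simp add: hom_of_def pure_tensor_def tensor_space_def)

end

theory Submission
  imports Defs
begin

text \<open>
  Elements of \<open>Hom(H \<otimes> H, A)\<close> are determined by their values on pure tensors, so every identity
  between such maps is an identity of Sweedler sums in \<open>A\<close>. A Sweedler sum is literally a finite
  sum over a chosen representation of \<open>\<Delta> h\<close>: it commutes with linear maps and with other Sweedler
  sums without any hypothesis on the summand. Bilinearity of the summand is needed only where the
  representation changes, namely for evaluation of maps at pure tensors, for linearity in \<open>h\<close>, for
  the formula for \<open>\<Delta> (h * g)\<close> and for coassociativity.

  The link between the partial actions of \<open>H\<close> on \<open>A\<close> and the global ones is
  \<open>(\<phi> a \<triangleleft> h) \<star> (g \<triangleright> \<phi> b) = \<phi> ((a \<leftharpoonup> h) * (g \<rightharpoonup> b))\<close> (\<open>phi_conv_actions\<close>). Evaluated at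
  \<open>k \<otimes> k'\<close> it is the left multiplicativity axiom for \<open>k\<close>, the commutation of the two partial
  actions and the right multiplicativity axiom for \<open>k'\<close>, applied in turn; \<open>h = g = 1\<close> gives
  multiplicativity of \<open>\<phi>\<close>. Injectivity follows from \<open>\<phi> a (1 \<otimes> 1) = a\<close>.

  It remains to see that \<open>B\<close> is closed under convolution. The antipode moves actions out of a
  product (\<open>la_conv_shift\<close> and \<open>ra_conv_shift\<close>):
  \<open>(h \<triangleright> f) \<star> g\<close> is the sum of the \<open>h\<^sub>1 \<triangleright> (f \<star> (S h\<^sub>2 \<triangleright> g))\<close>, and
  \<open>f \<star> (g \<triangleleft> l)\<close> is the sum of the \<open>((f \<triangleleft> S l\<^sub>1) \<star> g) \<triangleleft> l\<^sub>2\<close>. Hence the product of two generators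
  \<open>h \<triangleright> \<phi> a \<triangleleft> k\<close> and \<open>g \<triangleright> \<phi> b \<triangleleft> l\<close> is the sum of the
  \<open>h\<^sub>1 \<triangleright> ((\<phi> a \<triangleleft> (k * S l\<^sub>1)) \<star> ((S h\<^sub>2 * g) \<triangleright> \<phi> b)) \<triangleleft> l\<^sub>2\<close>, and the inner product lies in the image
  of \<open>\<phi>\<close> by the first identity.
\<close>

section \<open>Linear and bilinear maps\<close>

lemma bilinear_on_UNIV_iff:
  assumes "vector_space sV" "vector_space sW" "vector_space sU"
  shows "bilinear_on sV UNIV sW UNIV sU \<beta> \<longleftrightarrow>
    (\<forall>y. Vector_Spaces.linear sV sU (\<lambda>x. \<beta> x y)) \<and> (\<forall>x. Vector_Spaces.linear sW sU (\<beta> x))"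
  using assms by (auto simp: bilinear_on_def Vector_Spaces.linear_iff)

lemma linear_comp:
  assumes "Vector_Spaces.linear sV sU f" "Vector_Spaces.linear sU sW g"
  shows "Vector_Spaces.linear sV sW (\<lambda>x. g (f x))"
  using assms by (simp add: Vector_Spaces.linear_iff)

lemma linear_ext_commute:
  assumes "Vector_Spaces.linear sU sW L"
  shows "L (linear_ext sU f p) = linear_ext sW (\<lambda>x. L (f x)) p"
proof -
  interpret L: Vector_Spaces.linear sU sW L by fact
  show ?thesis by (simp add: linear_ext_def L.sum L.scale)
qed

lemma linear_ext_swap:
  assumes "vector_space sU"
  shows "linear_ext sU (\<lambda>x. linear_ext sU (f x) q) p = linear_ext sU (\<lambda>y. linear_ext sU (\<lambda>x. f x y) p) q"
proof -
  interpret U: vector_space sU by fact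
  show ?thesis
    unfolding linear_ext_def U.scale_sum_right
    by (subst sum.swap) (simp add: mult.commute)
qed

lemma linear_ext_parameter:
  assumes "vector_space sV" "vector_space sU" and "\<And>x. Vector_Spaces.linear sV sU (\<lambda>v. f v x)"
  shows "Vector_Spaces.linear sV sU (\<lambda>v. linear_ext sU (f v) p)"
proof -
  interpret U: vector_space sU by fact
  show ?thesis
    using assms
    by (simp add: Vector_Spaces.linear_iff linear_ext_def U.scale_right_distrib sum.distrib
        U.scale_sum_right mult.commute)
qed

section \<open>Sweedler sums\<close>

interpretation free: vector_space free_scale
  by (rule vector_space_free_scale)

lemma subspace_tensor_rel: "free.subspace (tensor_rel sV sW)"
  by (simp add: tensor_rel_def)

text \<open>
  The next four lemmas need no bilinearity of the summand: \<open>tensor_lift\<close> is a finite sum over a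
  chosen representation, which stays the same throughout each of them.
\<close>

lemma tensor_lift_commute:
  assumes "Vector_Spaces.linear sU sW L"
  shows "L (tensor_lift sU \<beta> t) = tensor_lift sW (\<lambda>x y. L (\<beta> x y)) t"
  unfolding tensor_lift_def linear_ext_commute[OF assms] by (simp add: case_prod_unfold)

lemma tensor_lift_swap:
  assumes "vector_space sU"
  shows "tensor_lift sU (\<lambda>x y. tensor_lift sU (\<lambda>u v. f x y u v) t) s =
    tensor_lift sU (\<lambda>u v. tensor_lift sU (\<lambda>x y. f x y u v) s) t"
  unfolding tensor_lift_def case_prod_unfold by (rule linear_ext_swap[OF assms])

lemma tensor_lift_parameter:
  assumes "vector_space sV" "vector_space sU"
    and "\<And>x y. Vector_Spaces.linear sV sU (\<lambda>v. f v x y)"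
  shows "Vector_Spaces.linear sV sU (\<lambda>v. tensor_lift sU (\<lambda>x y. f v x y) t)"
  unfolding tensor_lift_def case_prod_unfold
  by (rule linear_ext_parameter) (use assms in auto)

lemma tensor_lift_in_subspace:
  assumes "vector_space sU" "module.subspace sU B" "\<And>x y. \<beta> x y \<in> B"
  shows "tensor_lift sU \<beta> t \<in> B"
proof -
  interpret U: vector_space sU by fact
  show ?thesis
    unfolding tensor_lift_def linear_ext_def
    by (intro U.subspace_sum U.subspace_scale) (use assms in auto)
qed

lemma tensor_class_eqI:
  assumes "p - q \<in> tensor_rel sV sW"
  shows "tensor_class sV sW p = tensor_class sV sW q"
proof -
  have "r - p \<in> tensor_rel sV sW \<longleftrightarrow> r - q \<in> tensor_rel sV sW" for r
    using free.subspace_add[OF subspace_tensor_rel _ assms, of "r - p"]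
      free.subspace_diff[OF subspace_tensor_rel _ assms, of "r - q"] by auto
  then show ?thesis by (auto simp: tensor_class_def)
qed

lemma tensor_class_self: "p \<in> tensor_class sV sW p"
  by (simp add: tensor_class_def free.subspace_0[OF subspace_tensor_rel])

lemma tensor_add_class:
  "tensor_add sV sW (tensor_class sV sW p) (tensor_class sV sW q) = tensor_class sV sW (p + q)"
proof -
  have "tensor_class sV sW (p' + q') = tensor_class sV sW (p + q)"
    if "p' \<in> tensor_class sV sW p" "q' \<in> tensor_class sV sW q" for p' q'
  proof (rule tensor_class_eqI)
    have "p' + q' - (p + q) = (p' - p) + (q' - q)" by simp
    then show "p' + q' - (p + q) \<in> tensor_rel sV sW"
      using that free.subspace_add[OF subspace_tensor_rel]
      by (simp only: tensor_class_def mem_Collect_eq)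
  qed
  then have "tensor_add sV sW (tensor_class sV sW p) (tensor_class sV sW q) =
    (\<Union>p'\<in>tensor_class sV sW p. \<Union>q'\<in>tensor_class sV sW q. tensor_class sV sW (p + q))"
    by (simp add: tensor_add_def)
  moreover have "tensor_class sV sW p \<noteq> {}" "tensor_class sV sW q \<noteq> {}"
    using tensor_class_self by blast+
  ultimately show ?thesis by simp
qed

lemma tensor_scale_class:
  "tensor_scale sV sW c (tensor_class sV sW p) = tensor_class sV sW (free_scale c p)"
proof -
  have "tensor_class sV sW (free_scale c p') = tensor_class sV sW (free_scale c p)"
    if "p' \<in> tensor_class sV sW p" for p'
  proof (rule tensor_class_eqI)
    have "free_scale c p' - free_scale c p = free_scale c (p' - p)"
      by (simp add: free.scale_right_diff_distrib)
    then show "free_scale c p' - free_scale c p \<in> tensor_rel sV sW"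
      using that free.subspace_scale[OF subspace_tensor_rel]
      by (simp only: tensor_class_def mem_Collect_eq)
  qed
  then have "tensor_scale sV sW c (tensor_class sV sW p) =
    (\<Union>p'\<in>tensor_class sV sW p. tensor_class sV sW (free_scale c p))"
    by (simp add: tensor_scale_def)
  moreover have "tensor_class sV sW p \<noteq> {}"
    using tensor_class_self by blast
  ultimately show ?thesis by simp
qed

lemma tensor_lift_add:
  assumes "vector_space sU" "bilinear_on sV UNIV sW UNIV sU \<beta>"
    and "s \<in> tensor_space sV sW" "t \<in> tensor_space sV sW"
  shows "tensor_lift sU \<beta> (tensor_add sV sW s t) = tensor_lift sU \<beta> s + tensor_lift sU \<beta> t"
  using assms(3,4) linear_linear_ext[OF assms(1), of "\<lambda>(x, y). \<beta> x y"]
  by (auto simp: tensor_space_def tensor_add_class tensor_lift_class[OF assms(1,2)]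
      Vector_Spaces.linear_iff)

lemma tensor_lift_scale:
  assumes "vector_space sU" "bilinear_on sV UNIV sW UNIV sU \<beta>" and "t \<in> tensor_space sV sW"
  shows "tensor_lift sU \<beta> (tensor_scale sV sW c t) = sU c (tensor_lift sU \<beta> t)"
  using assms(3) linear_linear_ext[OF assms(1), of "\<lambda>(x, y). \<beta> x y"]
  by (auto simp: tensor_space_def tensor_scale_class tensor_lift_class[OF assms(1,2)]
      Vector_Spaces.linear_iff)

lemma tensor_add_closed:
  "tensor_add sV sW s t \<in> tensor_space sV sW"
  if "s \<in> tensor_space sV sW" "t \<in> tensor_space sV sW"
  using that by (auto simp: tensor_space_def tensor_add_class)

lemma tensor_scale_closed:
  "tensor_scale sV sW c t \<in> tensor_space sV sW" if "t \<in> tensor_space sV sW"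
  using that by (auto simp: tensor_space_def tensor_scale_class)

text \<open>
  Trilinear maps are well defined on the threefold tensor product; coassociativity is used through
  this fact.
\<close>

lemma linear_ext_tensor3:
  assumes U: "vector_space sU"
    and lin: "\<And>y z. Vector_Spaces.linear sV sU (\<lambda>x. T x y z)"
      "\<And>x z. Vector_Spaces.linear sV sU (\<lambda>y. T x y z)"
      "\<And>x y. Vector_Spaces.linear sV sU (\<lambda>z. T x y z)"
    and eq: "tensor3_class sV p = tensor3_class sV q"
  shows "linear_ext sU (\<lambda>(x, y, z). T x y z) p = linear_ext sU (\<lambda>(x, y, z). T x y z) q"
proof -
  interpret L: Vector_Spaces.linear free_scale sU "linear_ext sU (\<lambda>(x, y, z). T x y z)"
    by (rule linear_linear_ext[OF U])
  have "p \<in> tensor3_class sV p"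
    by (simp add: tensor3_class_def tensor3_rel_def free.span_zero)
  then have "p \<in> tensor3_class sV q"
    by (simp only: eq)
  then have "p - q \<in> tensor3_rel sV"
    by (simp add: tensor3_class_def)
  then have "linear_ext sU (\<lambda>(x, y, z). T x y z) (p - q) = 0"
    unfolding tensor3_rel_def
    by (rule L.eq_0_on_span[rotated])
       (use lin in \<open>auto simp: Vector_Spaces.linear_iff L.diff L.scale linear_ext_gen[OF U]\<close>)
  then show ?thesis by (simp add: L.diff)
qed

context hopf_algebra
begin

lemma linear_sweedler:
  assumes "vector_space sU" "bilinear_on scale UNIV scale UNIV sU \<beta>"
  shows "Vector_Spaces.linear scale sU (\<lambda>h. tensor_lift sU \<beta> (\<Delta> h))"
  using assms vector_space_axioms
  by (simp add: Vector_Spaces.linear_iff comult_add comult_scale comult_in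
      tensor_lift_add tensor_lift_scale)

lemma sweedler_mult:
  assumes U: "vector_space sU" and \<beta>: "bilinear_on scale UNIV scale UNIV sU \<beta>"
  shows "tensor_lift sU \<beta> (\<Delta> (h * g)) =
    tensor_lift sU (\<lambda>h\<^sub>1 h\<^sub>2. tensor_lift sU (\<lambda>g\<^sub>1 g\<^sub>2. \<beta> (h\<^sub>1 * g\<^sub>1) (h\<^sub>2 * g\<^sub>2)) (\<Delta> g)) (\<Delta> h)"
  by (simp add: comult_mult tensor_lift_class[OF U \<beta>] linear_ext_gen[OF U]
      tensor_lift_commute[OF linear_linear_ext[OF U]])

lemma sweedler_coassoc:
  assumes U: "vector_space sU"
    and lin: "\<And>y z. Vector_Spaces.linear scale sU (\<lambda>x. T x y z)"
      "\<And>x z. Vector_Spaces.linear scale sU (\<lambda>y. T x y z)"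
      "\<And>x y. Vector_Spaces.linear scale sU (\<lambda>z. T x y z)"
  shows "tensor_lift sU (\<lambda>x z. tensor_lift sU (\<lambda>u v. T u v z) (\<Delta> x)) (\<Delta> h) =
    tensor_lift sU (\<lambda>x z. tensor_lift sU (\<lambda>u v. T x u v) (\<Delta> z)) (\<Delta> h)"
  using linear_ext_tensor3[OF U lin coassoc[of h]]
  by (simp add: linear_ext_gen[OF U] tensor_lift_commute[OF linear_linear_ext[OF U]])

end

section \<open>The convolution algebra\<close>

text \<open>
  A Hopf algebra \<open>H\<close> together with a unital partial \<open>H\<close>-bimodule algebra \<open>A\<close>. Facts about \<open>H\<close> carry
  the prefix \<open>H\<close>, facts about the space of all functions with values in \<open>A\<close>, of which
  \<open>Hom(H \<otimes> H, A)\<close> is a subspace, the prefix \<open>F\<close>.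
\<close>

locale partial_bimodule_over_hopf =
  H: hopf_algebra sH \<Delta> \<epsilon> S + unital_partial_bimodule_algebra sA sH \<Delta> lp rp
  for sH :: "'k::field \<Rightarrow> 'h::ring_1 \<Rightarrow> 'h"
    and \<Delta> :: "'h \<Rightarrow> ('k, 'h, 'h) tensor" and \<epsilon> :: "'h \<Rightarrow> 'k" and S :: "'h \<Rightarrow> 'h"
    and sA :: "'k \<Rightarrow> 'a::ring \<Rightarrow> 'a"
    and lp :: "'h \<Rightarrow> 'a \<Rightarrow> 'a"  (infixr "\<rightharpoonup>" 75)
    and rp :: "'a \<Rightarrow> 'h \<Rightarrow> 'a"  (infixl "\<leftharpoonup>" 75)
begin

abbreviation sF where "sF \<equiv> (hom_scale sA :: 'k \<Rightarrow> (('k, 'h, 'h) tensor \<Rightarrow> 'a) \<Rightarrow> _)"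
abbreviation Hom where "Hom \<equiv> Hom_tensor sH sA"
abbreviation pure where "pure \<equiv> pure_tensor sH sH"
abbreviation conv  (infixl "\<star>" 70) where "f \<star> g \<equiv> convolution sH \<Delta> sA f g"
abbreviation la  (infixr "\<triangleright>" 75) where "h \<triangleright> f \<equiv> hom_left sH sA h f"
abbreviation ra  (infixl "\<triangleleft>" 75) where "f \<triangleleft> h \<equiv> hom_right sH sA f h"
abbreviation \<phi> where "\<phi> \<equiv> phi sH sA lp rp"
abbreviation B where "B \<equiv> generated_bimodule sH sA lp rp"

lemma vs_H: "vector_space sH" and vs_A: "vector_space sA"
  by unfold_locales

lemma vs_F: "vector_space sF"
  by unfold_locales
    (simp_all add: hom_scale_def fun_eq_iff scale_right_distrib scale_left_distrib)

lemmas bilinear_iff_H = bilinear_on_UNIV_iff[OF vs_H vs_H]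

lemma linear_mult_H:
  "Vector_Spaces.linear s sH f \<Longrightarrow> Vector_Spaces.linear s sH (\<lambda>x. f x * c)"
  "Vector_Spaces.linear s sH f \<Longrightarrow> Vector_Spaces.linear s sH (\<lambda>x. c * f x)"
  using H.mult_bilinear linear_comp[of s sH f sH "\<lambda>x. x * c"] linear_comp[of s sH f sH "\<lambda>x. c * x"]
  by (auto simp: bilinear_on_UNIV_iff vs_H)

lemma linear_mult_A:
  "Vector_Spaces.linear s sA f \<Longrightarrow> Vector_Spaces.linear s sA (\<lambda>x. f x * c)"
  "Vector_Spaces.linear s sA f \<Longrightarrow> Vector_Spaces.linear s sA (\<lambda>x. c * f x)"
  using mult_bilinear linear_comp[of s sA f sA "\<lambda>x. x * c"] linear_comp[of s sA f sA "\<lambda>x. c * x"]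
  by (auto simp: bilinear_on_UNIV_iff vs_A)

lemma linear_lp:
  "Vector_Spaces.linear s sH f \<Longrightarrow> Vector_Spaces.linear s sA (\<lambda>x. f x \<rightharpoonup> a)"
  "Vector_Spaces.linear s sA g \<Longrightarrow> Vector_Spaces.linear s sA (\<lambda>x. h \<rightharpoonup> g x)"
  using lp_bilinear linear_comp[of s sH f sA "\<lambda>x. x \<rightharpoonup> a"] linear_comp[of s sA g sA "\<lambda>x. h \<rightharpoonup> x"]
  by (auto simp: bilinear_on_UNIV_iff vs_A vs_H)

lemma linear_rp:
  "Vector_Spaces.linear s sH f \<Longrightarrow> Vector_Spaces.linear s sA (\<lambda>x. a \<leftharpoonup> f x)"
  "Vector_Spaces.linear s sA g \<Longrightarrow> Vector_Spaces.linear s sA (\<lambda>x. g x \<leftharpoonup> h)"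
  using rp_bilinear linear_comp[of s sH f sA "\<lambda>x. a \<leftharpoonup> x"] linear_comp[of s sA g sA "\<lambda>x. x \<leftharpoonup> h"]
  by (auto simp: bilinear_on_UNIV_iff vs_A vs_H)

lemma linear_id_H: "Vector_Spaces.linear sH sH (\<lambda>x. x)"
  by (simp add: Vector_Spaces.linear_iff vs_H)

lemma linear_sweedler_comp:
  assumes "\<And>y. Vector_Spaces.linear sH sA (\<lambda>x. \<beta> x y)" "\<And>x. Vector_Spaces.linear sH sA (\<beta> x)"
    and "Vector_Spaces.linear s sH f"
  shows "Vector_Spaces.linear s sA (\<lambda>x. tensor_lift sA \<beta> (\<Delta> (f x)))"
  using linear_comp[OF assms(3) H.linear_sweedler[OF vs_A, of \<beta>]] assms(1,2)
  by (simp add: bilinear_iff_H vs_A)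

lemma linear_tensor_lift:
  assumes "\<And>u v. Vector_Spaces.linear sH sA (\<lambda>x. \<beta> x u v)"
  shows "Vector_Spaces.linear sH sA (\<lambda>x. tensor_lift sA (\<lambda>u v. \<beta> x u v) t)"
  by (rule tensor_lift_parameter[OF vs_H vs_A assms])

lemma pure_add:
  "pure (x + x') y = tensor_add sH sH (pure x y) (pure x' y)"
  "pure x (y + y') = tensor_add sH sH (pure x y) (pure x y')"
  unfolding pure_tensor_def tensor_add_class
  by (rule tensor_class_eqI; simp add: tensor_rel_def; rule free.span_base;
      force simp: algebra_simps)+

lemma pure_scale:
  "pure (sH c x) y = tensor_scale sH sH c (pure x y)"
  "pure x (sH c y) = tensor_scale sH sH c (pure x y)"
  unfolding pure_tensor_def tensor_scale_class
  by (rule tensor_class_eqI; simp add: tensor_rel_def; rule free.span_base; force)+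

lemma pure_in: "pure x y \<in> tensor_space sH sH"
  by (simp add: pure_tensor_def tensor_space_def)

lemma linear_Hom:
  assumes "f \<in> Hom" "Vector_Spaces.linear s sH g"
  shows "Vector_Spaces.linear s sA (\<lambda>x. f (pure (g x) y))"
    and "Vector_Spaces.linear s sA (\<lambda>x. f (pure y (g x)))"
  using assms vs_A
  by (simp_all add: Hom_tensor_def Vector_Spaces.linear_iff pure_add pure_scale pure_in)

text \<open>
  Introduction rules that reduce linearity of an expression containing its variable once to linearity
  of the identity.
\<close>

lemmas linear_intros =
  linear_id_H linear_mult_H linear_mult_A linear_lp linear_rp
  linear_sweedler_comp linear_tensor_lift

lemma linear_ext_Hom:
  assumes "f \<in> Hom"
  shows "f (tensor_class sH sH p) = linear_ext sA (\<lambda>(x, y). f (pure x y)) p"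
proof -
  have L: "Vector_Spaces.linear free_scale sA (\<lambda>p. f (tensor_class sH sH p))"
    using assms vs_A
    by (auto simp: Vector_Spaces.linear_iff vector_space_free_scale Hom_tensor_def
        tensor_space_def tensor_add_class[symmetric] tensor_scale_class[symmetric])
  have p: "linear_ext free_scale gen p = p"
    by (rule poly_mapping_eqI)
      (simp add: linear_ext_def lookup_sum gen_def lookup_single when_def in_keys_iff
        if_distrib[of "\<lambda>x. _ * x"] cong: if_cong)
  show ?thesis
    using linear_ext_commute[OF L, of gen p] by (simp add: p pure_tensor_def case_prod_unfold)
qed

lemma Hom_eqI:
  assumes "f \<in> Hom" "g \<in> Hom" and "\<And>x y. f (pure x y) = g (pure x y)"
  shows "f = g"
proof
  fix t show "f t = g t"
  proof (cases "t \<in> tensor_space sH sH")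
    case True
    then obtain p where "t = tensor_class sH sH p" by (auto simp: tensor_space_def)
    then show ?thesis using linear_ext_Hom[of f p] linear_ext_Hom[of g p] assms by simp
  next
    case False
    then show ?thesis using assms(1,2) by (simp add: Hom_tensor_def)
  qed
qed

lemma hom_of_in_Hom:
  assumes "\<And>y. Vector_Spaces.linear sH sA (\<lambda>x. \<beta> x y)" "\<And>x. Vector_Spaces.linear sH sA (\<beta> x)"
  shows "hom_of sH sA \<beta> \<in> Hom"
  using assms vs_A tensor_lift_add[of sA sH sH \<beta>] tensor_lift_scale[of sA sH sH \<beta>]
  by (simp add: Hom_tensor_def hom_of_def bilinear_iff_H tensor_add_closed tensor_scale_closed)

lemma hom_of_apply:
  assumes "\<And>y. Vector_Spaces.linear sH sA (\<lambda>x. \<beta> x y)" "\<And>x. Vector_Spaces.linear sH sA (\<beta> x)"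
  shows "hom_of sH sA \<beta> (pure k k') = \<beta> k k'"
  using assms vs_A by (intro hom_of_pure) (simp_all add: bilinear_iff_H)

lemma phi_in_Hom: "\<phi> a \<in> Hom"
  unfolding phi_def by (rule hom_of_in_Hom) (intro linear_intros)+

lemma phi_apply: "\<phi> a (pure k k') = (k \<rightharpoonup> a) \<leftharpoonup> k'"
  unfolding phi_def by (rule hom_of_apply) (intro linear_intros)+

lemma la_in_Hom: "f \<in> Hom \<Longrightarrow> h \<triangleright> f \<in> Hom"
  unfolding hom_left_def by (rule hom_of_in_Hom) (intro linear_intros linear_Hom[of f]; assumption)+

lemma la_apply: "f \<in> Hom \<Longrightarrow> (h \<triangleright> f) (pure k k') = f (pure (k * h) k')"
  unfolding hom_left_def by (rule hom_of_apply) (intro linear_intros linear_Hom[of f]; assumption)+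

lemma ra_in_Hom: "f \<in> Hom \<Longrightarrow> f \<triangleleft> h \<in> Hom"
  unfolding hom_right_def by (rule hom_of_in_Hom) (intro linear_intros linear_Hom[of f]; assumption)+

lemma ra_apply: "f \<in> Hom \<Longrightarrow> (f \<triangleleft> h) (pure k k') = f (pure k (h * k'))"
  unfolding hom_right_def by (rule hom_of_apply) (intro linear_intros linear_Hom[of f]; assumption)+

lemma conv_in_Hom: "f \<in> Hom \<Longrightarrow> g \<in> Hom \<Longrightarrow> f \<star> g \<in> Hom"
  unfolding convolution_def
  by (rule hom_of_in_Hom) (intro linear_intros linear_Hom[of f] linear_Hom[of g]; assumption)+

lemma conv_apply: "f \<in> Hom \<Longrightarrow> g \<in> Hom \<Longrightarrow> (f \<star> g) (pure k k') =
    tensor_lift sA (\<lambda>k\<^sub>1 k\<^sub>2. tensor_lift sA (\<lambda>k'\<^sub>1 k'\<^sub>2. f (pure k\<^sub>1 k'\<^sub>1) * g (pure k\<^sub>2 k'\<^sub>2)) (\<Delta> k')) (\<Delta> k)"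
  unfolding convolution_def
  by (rule hom_of_apply) (intro linear_intros linear_Hom[of f] linear_Hom[of g]; assumption)+


sublocale F: vector_space sF
  by (rule vs_F)

lemma subspace_Hom: "F.subspace Hom"
  using vs_A
  by (auto simp: F.subspace_def Hom_tensor_def hom_scale_def scale_right_distrib mult.commute)

lemma linear_HomI:
  assumes "\<And>h. F h \<in> Hom" "\<And>k k'. Vector_Spaces.linear sH sA (\<lambda>h. F h (pure k k'))"
  shows "Vector_Spaces.linear sH sF F"
proof -
  have "F (x + y) = F x + F y" for x y
    by (rule Hom_eqI)
      (use assms F.subspace_add[OF subspace_Hom] in \<open>simp_all add: Vector_Spaces.linear_iff\<close>)
  moreover have "F (sH c x) = sF c (F x)" for c x
    by (rule Hom_eqI)
      (use assms F.subspace_scale[OF subspace_Hom] in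
        \<open>simp_all add: Vector_Spaces.linear_iff hom_scale_def\<close>)
  ultimately show ?thesis by (simp add: Vector_Spaces.linear_iff vs_H vs_F)
qed

lemma linear_la_H: "f \<in> Hom \<Longrightarrow> Vector_Spaces.linear sH sF (\<lambda>h. h \<triangleright> f)"
  by (rule linear_HomI, simp_all add: la_in_Hom la_apply) (intro linear_intros linear_Hom[of f]; assumption)

lemma linear_ra_H: "f \<in> Hom \<Longrightarrow> Vector_Spaces.linear sH sF (\<lambda>h. f \<triangleleft> h)"
  by (rule linear_HomI, simp_all add: ra_in_Hom ra_apply) (intro linear_intros linear_Hom[of f]; assumption)

lemma linear_eval: "Vector_Spaces.linear sF sA (\<lambda>f. f t)"
  by (simp add: Vector_Spaces.linear_iff vs_F vs_A hom_scale_def)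

lemma tensor_lift_F_apply: "tensor_lift sF \<beta> t u = tensor_lift sA (\<lambda>x y. \<beta> x y u) t"
  by (rule tensor_lift_commute[OF linear_eval])

text \<open>
  The dependence on a function argument is linear on the space of all functions: bilinearity of
  \<open>\<beta>\<close> plays no role, as the value at \<open>t\<close> is a sum over a representation of \<open>t\<close> that does not
  depend on \<open>f\<close>. So the actions and the convolution need not be restricted to \<open>Hom\<close> here.
\<close>

lemma linear_hom_of:
  assumes "\<And>k k'. Vector_Spaces.linear sF sA (\<lambda>f. \<beta> f k k')"
  shows "Vector_Spaces.linear sF sF (\<lambda>f. hom_of sH sA (\<beta> f))"
proof -
  have "Vector_Spaces.linear sF sA (\<lambda>f. tensor_lift sA (\<beta> f) t)" for t
    by (rule tensor_lift_parameter[OF vs_F vs_A assms])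
  then show ?thesis
    by (simp add: Vector_Spaces.linear_iff hom_of_def hom_scale_def fun_eq_iff)
qed

lemma linear_la: "Vector_Spaces.linear sF sF (\<lambda>f. h \<triangleright> f)"
  unfolding hom_left_def by (intro linear_hom_of linear_eval)

lemma linear_ra: "Vector_Spaces.linear sF sF (\<lambda>f. f \<triangleleft> h)"
  unfolding hom_right_def by (intro linear_hom_of linear_eval)

lemma linear_conv_left: "Vector_Spaces.linear sF sF (\<lambda>f. f \<star> g)"
  unfolding convolution_def
  by (intro linear_hom_of tensor_lift_parameter vs_F vs_A linear_mult_A linear_eval)

lemma linear_conv_right: "Vector_Spaces.linear sF sF (\<lambda>g. f \<star> g)"
  unfolding convolution_def
  by (intro linear_hom_of tensor_lift_parameter vs_F vs_A linear_mult_A linear_eval)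

lemma la_one: "f \<in> Hom \<Longrightarrow> 1 \<triangleright> f = f"
  by (rule Hom_eqI) (simp_all add: la_in_Hom la_apply)

lemma ra_one: "f \<in> Hom \<Longrightarrow> f \<triangleleft> 1 = f"
  by (rule Hom_eqI) (simp_all add: ra_in_Hom ra_apply)

lemma la_la: "f \<in> Hom \<Longrightarrow> h \<triangleright> (g \<triangleright> f) = (h * g) \<triangleright> f"
  by (rule Hom_eqI) (simp_all add: la_in_Hom la_apply mult.assoc)

lemma ra_ra: "f \<in> Hom \<Longrightarrow> (f \<triangleleft> g) \<triangleleft> h = f \<triangleleft> (g * h)"
  by (rule Hom_eqI) (simp_all add: ra_in_Hom ra_apply mult.assoc)

lemma la_ra: "f \<in> Hom \<Longrightarrow> h \<triangleright> (f \<triangleleft> g) = (h \<triangleright> f) \<triangleleft> g"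
  by (rule Hom_eqI) (simp_all add: la_in_Hom ra_in_Hom la_apply ra_apply)

lemma sweedler_in_Hom: "(\<And>x y. \<beta> x y \<in> Hom) \<Longrightarrow> tensor_lift sF \<beta> t \<in> Hom"
  by (rule tensor_lift_in_subspace[OF vs_F subspace_Hom])

text \<open>
  At \<open>k \<otimes> k'\<close> both sides are the sum of the \<open>f (k\<^sub>1 h\<^sub>1 \<otimes> k'\<^sub>1) * g (k\<^sub>2 h\<^sub>2 \<otimes> k'\<^sub>2)\<close>; the order of
  summation differs.
\<close>

lemma conv_la:
  assumes f: "f \<in> Hom" and g: "g \<in> Hom"
  shows "h \<triangleright> (f \<star> g) = tensor_lift sF (\<lambda>h\<^sub>1 h\<^sub>2. (h\<^sub>1 \<triangleright> f) \<star> (h\<^sub>2 \<triangleright> g)) (\<Delta> h)"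
proof (rule Hom_eqI)
  fix k k'
  let ?P = "\<lambda>u v. tensor_lift sA (\<lambda>x y. f (pure u x) * g (pure v y)) (\<Delta> k')"
  have P: "bilinear_on sH UNIV sH UNIV sA ?P"
    unfolding bilinear_iff_H[OF vs_A]
    by (intro conjI allI linear_intros linear_Hom[OF f] linear_Hom[OF g])
  have "(h \<triangleright> (f \<star> g)) (pure k k') = tensor_lift sA ?P (\<Delta> (k * h))"
    by (simp add: la_apply conv_apply conv_in_Hom f g)
  also have "\<dots> = tensor_lift sA (\<lambda>u v. tensor_lift sA (\<lambda>h\<^sub>1 h\<^sub>2. ?P (u * h\<^sub>1) (v * h\<^sub>2)) (\<Delta> h)) (\<Delta> k)"
    by (rule H.sweedler_mult[OF vs_A P])
  also have "\<dots> = tensor_lift sA (\<lambda>h\<^sub>1 h\<^sub>2. tensor_lift sA (\<lambda>u v. ?P (u * h\<^sub>1) (v * h\<^sub>2)) (\<Delta> k)) (\<Delta> h)"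
    by (rule tensor_lift_swap[OF vs_A])
  also have "\<dots> = tensor_lift sF (\<lambda>h\<^sub>1 h\<^sub>2. (h\<^sub>1 \<triangleright> f) \<star> (h\<^sub>2 \<triangleright> g)) (\<Delta> h) (pure k k')"
    by (simp add: tensor_lift_F_apply la_apply conv_apply la_in_Hom f g)
  finally show "(h \<triangleright> (f \<star> g)) (pure k k') = \<dots>" .
qed (intro sweedler_in_Hom conv_in_Hom la_in_Hom f g)+

lemma conv_ra:
  assumes f: "f \<in> Hom" and g: "g \<in> Hom"
  shows "(f \<star> g) \<triangleleft> h = tensor_lift sF (\<lambda>h\<^sub>1 h\<^sub>2. (f \<triangleleft> h\<^sub>1) \<star> (g \<triangleleft> h\<^sub>2)) (\<Delta> h)"
proof (rule Hom_eqI)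
  fix k k'
  let ?P = "\<lambda>u v x y. f (pure u x) * g (pure v y)"
  have P: "bilinear_on sH UNIV sH UNIV sA (?P u v)" for u v
    unfolding bilinear_iff_H[OF vs_A]
    by (intro conjI allI linear_intros linear_Hom[OF f] linear_Hom[OF g])
  have "((f \<star> g) \<triangleleft> h) (pure k k') =
    tensor_lift sA (\<lambda>u v. tensor_lift sA (?P u v) (\<Delta> (h * k'))) (\<Delta> k)"
    by (simp add: ra_apply conv_apply conv_in_Hom f g)
  also have "\<dots> = tensor_lift sA (\<lambda>u v. tensor_lift sA (\<lambda>h\<^sub>1 h\<^sub>2.
      tensor_lift sA (\<lambda>x y. ?P u v (h\<^sub>1 * x) (h\<^sub>2 * y)) (\<Delta> k')) (\<Delta> h)) (\<Delta> k)"
    by (simp only: H.sweedler_mult[OF vs_A P])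
  also have "\<dots> = tensor_lift sA (\<lambda>h\<^sub>1 h\<^sub>2. tensor_lift sA (\<lambda>u v.
      tensor_lift sA (\<lambda>x y. ?P u v (h\<^sub>1 * x) (h\<^sub>2 * y)) (\<Delta> k')) (\<Delta> k)) (\<Delta> h)"
    by (rule tensor_lift_swap[OF vs_A])
  also have "\<dots> = tensor_lift sF (\<lambda>h\<^sub>1 h\<^sub>2. (f \<triangleleft> h\<^sub>1) \<star> (g \<triangleleft> h\<^sub>2)) (\<Delta> h) (pure k k')"
    by (simp add: tensor_lift_F_apply ra_apply conv_apply ra_in_Hom f g)
  finally show "((f \<star> g) \<triangleleft> h) (pure k k') = \<dots>" .
qed (intro sweedler_in_Hom ra_in_Hom conv_in_Hom f g)+

lemma sweedler_mult_const:
  "tensor_lift sA \<beta> t * c = tensor_lift sA (\<lambda>x y. \<beta> x y * c) t"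
  "c * tensor_lift sA \<beta> t = tensor_lift sA (\<lambda>x y. c * \<beta> x y) t"
  using linear_mult_A[of sA "\<lambda>x. x" c] vs_A
  by (auto intro!: tensor_lift_commute simp: Vector_Spaces.linear_iff)

text \<open>
  Coassociativity is applied once to \<open>k\<close> and once to \<open>k'\<close>; the exchanges of sums before and after bring
  the two Sweedler sums belonging to each variable next to each other.
\<close>

lemma conv_assoc:
  assumes f: "f \<in> Hom" and g: "g \<in> Hom" and d: "d \<in> Hom"
  shows "(f \<star> g) \<star> d = f \<star> (g \<star> d)"
proof (rule Hom_eqI)
  fix k k'
  let ?T = "\<lambda>u u' v v' z z'. f (pure u u') * g (pure v v') * d (pure z z')"
  let ?D = "tensor_lift sA"
  note lin = linear_intros linear_Hom[OF f] linear_Hom[OF g] linear_Hom[OF d]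
  have "((f \<star> g) \<star> d) (pure k k') =
    ?D (\<lambda>x z. ?D (\<lambda>x' z'. ?D (\<lambda>u v. ?D (\<lambda>u' v'. ?T u u' v v' z z') (\<Delta> x')) (\<Delta> x)) (\<Delta> k')) (\<Delta> k)"
    by (simp add: conv_apply conv_in_Hom f g d sweedler_mult_const)
  also have "\<dots> =
    ?D (\<lambda>x z. ?D (\<lambda>u v. ?D (\<lambda>x' z'. ?D (\<lambda>u' v'. ?T u u' v v' z z') (\<Delta> x')) (\<Delta> k')) (\<Delta> x)) (\<Delta> k)"
    by (subst tensor_lift_swap[OF vs_A]) (rule refl)
  also have "\<dots> =
    ?D (\<lambda>x z. ?D (\<lambda>u v. ?D (\<lambda>u' x'. ?D (\<lambda>v' z'. ?T u u' v v' z z') (\<Delta> x')) (\<Delta> k')) (\<Delta> x)) (\<Delta> k)"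
    by (subst H.sweedler_coassoc[OF vs_A]) (intro lin refl)+
  also have "\<dots> =
    ?D (\<lambda>u x. ?D (\<lambda>v z. ?D (\<lambda>u' x'. ?D (\<lambda>v' z'. ?T u u' v v' z z') (\<Delta> x')) (\<Delta> k')) (\<Delta> x)) (\<Delta> k)"
    by (rule H.sweedler_coassoc[OF vs_A]) (intro lin)+
  also have "\<dots> =
    ?D (\<lambda>u x. ?D (\<lambda>u' x'. ?D (\<lambda>v z. ?D (\<lambda>v' z'. ?T u u' v v' z z') (\<Delta> x')) (\<Delta> x)) (\<Delta> k')) (\<Delta> k)"
    by (subst tensor_lift_swap[OF vs_A]) (rule refl)
  also have "\<dots> = (f \<star> (g \<star> d)) (pure k k')"
    by (simp add: conv_apply conv_in_Hom f g d sweedler_mult_const mult.assoc)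
  finally show "((f \<star> g) \<star> d) (pure k k') = \<dots>" .
qed (intro conv_in_Hom f g d)+

section \<open>The embedding\<close>

lemma linear_phi: "Vector_Spaces.linear sA sF \<phi>"
proof -
  have lin: "Vector_Spaces.linear sA sA (\<lambda>a. (k \<rightharpoonup> a) \<leftharpoonup> k')" for k k'
    by (intro linear_intros) (simp add: Vector_Spaces.linear_iff vs_A)
  have "\<phi> (a + b) = \<phi> a + \<phi> b" for a b
    by (rule Hom_eqI)
      (use lin phi_in_Hom F.subspace_add[OF subspace_Hom] in
        \<open>simp_all add: Vector_Spaces.linear_iff phi_apply\<close>)
  moreover have "\<phi> (sA c a) = sF c (\<phi> a)" for c a
    by (rule Hom_eqI)
      (use lin phi_in_Hom F.subspace_scale[OF subspace_Hom] in
        \<open>simp_all add: Vector_Spaces.linear_iff phi_apply hom_scale_def\<close>)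
  ultimately show ?thesis by (simp add: Vector_Spaces.linear_iff vs_A vs_F)
qed

lemma inj_phi: "inj \<phi>"
proof (rule injI)
  fix a b assume "\<phi> a = \<phi> b"
  then have "\<phi> a (pure 1 1) = \<phi> b (pure 1 1)" by simp
  then show "a = b" by (simp add: phi_apply lp_one rp_one)
qed

text \<open>
  The compatibility of \<open>\<phi>\<close> with the partial actions. Taking \<open>h = g = 1\<close>, it says that \<open>\<phi>\<close> is
  multiplicative.
\<close>

lemma phi_conv_actions: "(\<phi> a \<triangleleft> h) \<star> (g \<triangleright> \<phi> b) = \<phi> ((a \<leftharpoonup> h) * (g \<rightharpoonup> b))"
proof (rule Hom_eqI)
  fix k k'
  have rp: "Vector_Spaces.linear sA sA (\<lambda>x. x \<leftharpoonup> k')"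
    by (intro linear_intros) (simp add: Vector_Spaces.linear_iff vs_A)
  have "\<phi> ((a \<leftharpoonup> h) * (g \<rightharpoonup> b)) (pure k k') =
    tensor_lift sA (\<lambda>k\<^sub>1 k\<^sub>2. (((k\<^sub>1 \<rightharpoonup> a) \<leftharpoonup> h) * ((k\<^sub>2 * g) \<rightharpoonup> b)) \<leftharpoonup> k') (\<Delta> k)"
    by (simp add: phi_apply lp_mult lp_rp tensor_lift_commute[OF rp])
  also have "\<dots> = ((\<phi> a \<triangleleft> h) \<star> (g \<triangleright> \<phi> b)) (pure k k')"
    by (simp add: rp_mult conv_apply ra_apply la_apply ra_in_Hom la_in_Hom phi_in_Hom phi_apply)
  finally show "((\<phi> a \<triangleleft> h) \<star> (g \<triangleright> \<phi> b)) (pure k k') = \<phi> ((a \<leftharpoonup> h) * (g \<rightharpoonup> b)) (pure k k')"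
    by simp
qed (intro conv_in_Hom la_in_Hom ra_in_Hom phi_in_Hom)+

section \<open>The generated bimodule is a subalgebra\<close>

text \<open>
  Expanding the right-hand side gives the sum of the \<open>(h\<^sub>1 \<triangleright> f) \<star> ((h\<^sub>2 * S h\<^sub>3) \<triangleright> g)\<close>, which collapses
  by the antipode and counit axioms.
\<close>

lemma la_conv_shift:
  assumes f: "f \<in> Hom" and g: "g \<in> Hom"
  shows "(h \<triangleright> f) \<star> g = tensor_lift sF (\<lambda>h\<^sub>1 h\<^sub>2. h\<^sub>1 \<triangleright> (f \<star> (S h\<^sub>2 \<triangleright> g))) (\<Delta> h)"
proof -
  let ?D = "tensor_lift sF"
  have S: "Vector_Spaces.linear sH sH (\<lambda>z. c * S z)" for c
    by (intro linear_intros H.antipode_linear)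
  have "?D (\<lambda>h\<^sub>1 h\<^sub>2. h\<^sub>1 \<triangleright> (f \<star> (S h\<^sub>2 \<triangleright> g))) (\<Delta> h) =
    ?D (\<lambda>h\<^sub>1 h\<^sub>2. ?D (\<lambda>u v. (u \<triangleright> f) \<star> ((v * S h\<^sub>2) \<triangleright> g)) (\<Delta> h\<^sub>1)) (\<Delta> h)"
    by (simp add: conv_la la_la la_in_Hom f g)
  also have "\<dots> = ?D (\<lambda>h\<^sub>1 h\<^sub>2. ?D (\<lambda>u v. (h\<^sub>1 \<triangleright> f) \<star> ((u * S v) \<triangleright> g)) (\<Delta> h\<^sub>2)) (\<Delta> h)"
  proof (rule H.sweedler_coassoc[OF vs_F])
    show "Vector_Spaces.linear sH sF (\<lambda>x. (x \<triangleright> f) \<star> ((y * S z) \<triangleright> g))" for y z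
      by (rule linear_comp[OF linear_la_H[OF f] linear_conv_left])
    show "Vector_Spaces.linear sH sF (\<lambda>y. (x \<triangleright> f) \<star> ((y * S z) \<triangleright> g))" for x z
      by (rule linear_comp[OF linear_comp[OF _ linear_la_H[OF g]] linear_conv_right])
        (intro linear_intros)
    show "Vector_Spaces.linear sH sF (\<lambda>z. (x \<triangleright> f) \<star> ((y * S z) \<triangleright> g))" for x y
      by (rule linear_comp[OF linear_comp[OF S linear_la_H[OF g]] linear_conv_right])
  qed
  also have "\<dots> = ?D (\<lambda>h\<^sub>1 h\<^sub>2. (h\<^sub>1 \<triangleright> f) \<star> (sH (\<epsilon> h\<^sub>2) 1 \<triangleright> g)) (\<Delta> h)"
    by (simp only: tensor_lift_commute[OF linear_comp[OF linear_la_H[OF g] linear_conv_right],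
          symmetric] H.antipode_right)
  also have "\<dots> = ?D (\<lambda>h\<^sub>1 h\<^sub>2. (sH (\<epsilon> h\<^sub>2) h\<^sub>1 \<triangleright> f) \<star> g) (\<Delta> h)"
    using linear_la_H[OF f] linear_la_H[OF g] linear_conv_left linear_conv_right
    by (simp add: Vector_Spaces.linear_iff la_one f g)
  also have "\<dots> = (h \<triangleright> f) \<star> g"
    by (simp only: tensor_lift_commute[OF linear_comp[OF linear_la_H[OF f] linear_conv_left],
          symmetric] H.counit_right)
  finally show ?thesis ..
qed

text \<open>
  Expanding the right-hand side gives the sum of the \<open>(f \<triangleleft> (S h\<^sub>1 * h\<^sub>2)) \<star> (g \<triangleleft> h\<^sub>3)\<close>.
\<close>

lemma ra_conv_shift:
  assumes f: "f \<in> Hom" and g: "g \<in> Hom"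
  shows "f \<star> (g \<triangleleft> h) = tensor_lift sF (\<lambda>h\<^sub>1 h\<^sub>2. ((f \<triangleleft> S h\<^sub>1) \<star> g) \<triangleleft> h\<^sub>2) (\<Delta> h)"
proof -
  let ?D = "tensor_lift sF"
  have S: "Vector_Spaces.linear sH sH (\<lambda>z. S z * c)" for c
    by (intro linear_intros H.antipode_linear)
  have "?D (\<lambda>h\<^sub>1 h\<^sub>2. ((f \<triangleleft> S h\<^sub>1) \<star> g) \<triangleleft> h\<^sub>2) (\<Delta> h) =
    ?D (\<lambda>h\<^sub>1 h\<^sub>2. ?D (\<lambda>u v. (f \<triangleleft> (S h\<^sub>1 * u)) \<star> (g \<triangleleft> v)) (\<Delta> h\<^sub>2)) (\<Delta> h)"
    by (simp add: conv_ra ra_ra ra_in_Hom f g)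
  also have "\<dots> = ?D (\<lambda>h\<^sub>1 h\<^sub>2. ?D (\<lambda>u v. (f \<triangleleft> (S u * v)) \<star> (g \<triangleleft> h\<^sub>2)) (\<Delta> h\<^sub>1)) (\<Delta> h)"
  proof (rule H.sweedler_coassoc[OF vs_F, symmetric])
    show "Vector_Spaces.linear sH sF (\<lambda>z. (f \<triangleleft> (S x * y)) \<star> (g \<triangleleft> z))" for x y
      by (rule linear_comp[OF linear_ra_H[OF g] linear_conv_right])
    show "Vector_Spaces.linear sH sF (\<lambda>y. (f \<triangleleft> (S x * y)) \<star> (g \<triangleleft> z))" for x z
      by (rule linear_comp[OF linear_comp[OF _ linear_ra_H[OF f]] linear_conv_left])
        (intro linear_intros)
    show "Vector_Spaces.linear sH sF (\<lambda>x. (f \<triangleleft> (S x * y)) \<star> (g \<triangleleft> z))" for y z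
      by (rule linear_comp[OF linear_comp[OF S linear_ra_H[OF f]] linear_conv_left])
  qed
  also have "\<dots> = ?D (\<lambda>h\<^sub>1 h\<^sub>2. (f \<triangleleft> sH (\<epsilon> h\<^sub>1) 1) \<star> (g \<triangleleft> h\<^sub>2)) (\<Delta> h)"
    by (simp only: tensor_lift_commute[OF linear_comp[OF linear_ra_H[OF f] linear_conv_left],
          symmetric] H.antipode_left)
  also have "\<dots> = ?D (\<lambda>h\<^sub>1 h\<^sub>2. f \<star> (g \<triangleleft> sH (\<epsilon> h\<^sub>1) h\<^sub>2)) (\<Delta> h)"
    using linear_ra_H[OF f] linear_ra_H[OF g] linear_conv_left linear_conv_right
    by (simp add: Vector_Spaces.linear_iff ra_one f g)
  also have "\<dots> = f \<star> (g \<triangleleft> h)"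
    by (simp only: tensor_lift_commute[OF linear_comp[OF linear_ra_H[OF g] linear_conv_right],
          symmetric] H.counit_left)
  finally show ?thesis ..
qed

lemma subspace_B: "F.subspace B"
  by (simp add: generated_bimodule_def)

lemma generator_in_B: "(h \<triangleright> \<phi> a) \<triangleleft> k \<in> B"
  unfolding generated_bimodule_def by (rule F.span_base) blast

text \<open>
  As \<open>L\<close> is linear on the space of all functions, to show that it preserves \<open>B\<close> it suffices to
  consider generators.
\<close>

lemma linear_into_B:
  assumes L: "Vector_Spaces.linear sF sF L" and "\<And>h a k. L ((h \<triangleright> \<phi> a) \<triangleleft> k) \<in> B" and "f \<in> B"
  shows "L f \<in> B"
proof -
  interpret L: Vector_Spaces.linear sF sF L by (rule L)
  have "F.subspace {f. L f \<in> B}"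
    by (rule L.subspace_vimage[OF subspace_B, unfolded vimage_def])
  then have "B \<subseteq> {f. L f \<in> B}"
    by (subst (1) generated_bimodule_def, intro F.span_minimal) (use assms(2) in auto)
  then show ?thesis using assms(3) by blast
qed

lemma B_subset_Hom: "B \<subseteq> Hom"
  unfolding generated_bimodule_def
  by (rule F.span_minimal[OF _ subspace_Hom]) (auto intro: ra_in_Hom la_in_Hom phi_in_Hom)

lemma la_in_B: "f \<in> B \<Longrightarrow> h \<triangleright> f \<in> B"
  by (rule linear_into_B[OF linear_la])
    (simp_all add: la_ra la_la la_in_Hom phi_in_Hom generator_in_B)

lemma ra_in_B: "f \<in> B \<Longrightarrow> f \<triangleleft> h \<in> B"
  by (rule linear_into_B[OF linear_ra])
    (simp_all add: ra_ra la_in_Hom phi_in_Hom generator_in_B)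

lemma phi_in_B: "\<phi> a \<in> B"
  using generator_in_B[of 1 a 1] by (simp add: la_one ra_one phi_in_Hom)

lemma sweedler_in_B: "(\<And>x y. \<beta> x y \<in> B) \<Longrightarrow> tensor_lift sF \<beta> t \<in> B"
  by (rule tensor_lift_in_subspace[OF vs_F subspace_B])

text \<open>
  The right action of \<open>l\<close> and the left action of \<open>h\<close> are moved out of the product by the shift lemmas;
  what remains is a product as in \<open>phi_conv_actions\<close>.
\<close>

lemma conv_generators_in_B: "((h \<triangleright> \<phi> a) \<triangleleft> k) \<star> ((g \<triangleright> \<phi> b) \<triangleleft> l) \<in> B"
proof -
  note Hom = la_in_Hom ra_in_Hom phi_in_Hom
  have inner: "(\<phi> a \<triangleleft> k) \<star> ((m \<triangleright> \<phi> b) \<triangleleft> l) \<in> B" for m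
    by (simp add: ra_conv_shift ra_ra Hom phi_conv_actions)
      (intro sweedler_in_B ra_in_B phi_in_B)
  have "((h \<triangleright> \<phi> a) \<triangleleft> k) \<star> ((g \<triangleright> \<phi> b) \<triangleleft> l) =
    tensor_lift sF (\<lambda>h\<^sub>1 h\<^sub>2. h\<^sub>1 \<triangleright> ((\<phi> a \<triangleleft> k) \<star> (((S h\<^sub>2 * g) \<triangleright> \<phi> b) \<triangleleft> l))) (\<Delta> h)"
    by (simp add: la_ra[symmetric] la_conv_shift la_la Hom)
  also have "\<dots> \<in> B"
    by (intro sweedler_in_B la_in_B inner)
  finally show ?thesis .
qed

lemma conv_in_B: "f \<in> B \<Longrightarrow> g \<in> B \<Longrightarrow> f \<star> g \<in> B"
  by (rule linear_into_B[OF linear_conv_left _], rule linear_into_B[OF linear_conv_right])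
    (auto intro: conv_generators_in_B)

lemma globalization_B: "globalization sA sH \<Delta> lp rp sF B (convolution sH \<Delta> sA)
  (hom_left sH sA) (hom_right sH sA) \<phi>"
proof -
  note in_Hom = subsetD[OF B_subset_Hom]
  show ?thesis
  proof unfold_locales
    show "bilinear_on sF B sF B sF (convolution sH \<Delta> sA)"
      using linear_conv_left linear_conv_right
      by (auto simp: bilinear_on_def Vector_Spaces.linear_iff)
    show "bilinear_on sH UNIV sF B sF (hom_left sH sA)"
      using linear_la linear_la_H in_Hom
      by (auto simp: bilinear_on_def Vector_Spaces.linear_iff)
    show "bilinear_on sF B sH UNIV sF (hom_right sH sA)"
      using linear_ra linear_ra_H in_Hom
      by (auto simp: bilinear_on_def Vector_Spaces.linear_iff)
    show "\<phi> (a * b) = \<phi> a \<star> \<phi> b" for a b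
      using phi_conv_actions[of a 1 1 b] by (simp add: la_one ra_one phi_in_Hom lp_one rp_one)
    show "B = F.span {(h \<triangleright> \<phi> a) \<triangleleft> k | h a k. True}"
      by (simp add: generated_bimodule_def)
    show "\<phi> (a + b) = \<phi> a + \<phi> b" "\<phi> (sA c a) = sF c (\<phi> a)" for a b c
      using linear_phi by (simp_all add: Vector_Spaces.linear_iff)
  qed (intro subspace_B conv_in_B la_in_B ra_in_B phi_in_B inj_phi phi_conv_actions
      conv_assoc la_one ra_one la_la ra_ra la_ra conv_la conv_ra in_Hom; assumption)+
qed

end

theorem theorem3p5:
  fixes sH :: "'k::field \<Rightarrow> 'h::ring_1 \<Rightarrow> 'h"
    and \<Delta> :: "'h \<Rightarrow> ('k, 'h, 'h) tensor" and \<epsilon> :: "'h \<Rightarrow> 'k" and S :: "'h \<Rightarrow> 'h"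
    and sA :: "'k \<Rightarrow> 'a::ring \<Rightarrow> 'a"
    and lp :: "'h \<Rightarrow> 'a \<Rightarrow> 'a" and rp :: "'a \<Rightarrow> 'h \<Rightarrow> 'a"
  assumes "hopf_algebra sH \<Delta> \<epsilon> S"
    and "unital_partial_bimodule_algebra sA sH \<Delta> lp rp"
  shows "generated_bimodule sH sA lp rp \<subseteq> Hom_tensor sH sA \<and>
    globalization sA sH \<Delta> lp rp
      (hom_scale sA) (generated_bimodule sH sA lp rp) (convolution sH \<Delta> sA)
      (hom_left sH sA) (hom_right sH sA) (phi sH sA lp rp)"
proof -
  interpret partial_bimodule_over_hopf sH \<Delta> \<epsilon> S sA lp rp
    using assms by (rule partial_bimodule_over_hopf.intro)
  show ?thesis
    using B_subset_Hom globalization_B by (rule conjI)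
qed

end
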